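(* Let $n\ge 1$ and let $p_1,\ldots,p_n\in[0,1]$. Let $X_1,\ldots,X_n$ and $\tilde X_1,\ldots,\tilde X_n$ be two collections of Bernoulli random variables such that $X_i\sim\mathrm{Bernoulli}(p_i)$ and $\tilde X_i\sim\mathrm{Bernoulli}(p_i)$ for each $i$, and the $\tilde X_i$ are mutually independent (and independent of the $X_i$); no assumption is made on the joint distribution of the $X_i$. Put $Z=\sum_{i=1}^n X_i$, $\tilde Z=\sum_{i=1}^n\tilde X_i$, $S=\sum_{i=1}^n p_i$, and $B=S+S^2$. For $i\neq j$ let $\eta_{ij}=\left(\mathbb{E}[X_iX_j]-p_ip_j\right)_+$, let $\eta_{ii}=0$, and let $H=\sum_{i=1}^n\sum_{j=1}^n\eta_{ij}$. Then $$\mathbb{P}(Z>0)\ \ge\ \frac12\left(1-\frac{H}{B+H}\right)\mathbb{P}(\tilde Z>0).$$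
   Context: For real $x$, $(x)_+=\max\{x,0\}$. In the degenerate case $B+H=0$ (i.e. all $p_i=0$) the fraction $H/(B+H)$ is interpreted as $0$. *)

theory Defs
  imports "HOL-Probability.Probability"
begin

text \<open>The library's \<^const>\<open>bernoulli_pmf\<close> is a distribution on \<^typ>\<open>bool\<close>; here it is
  pushed forward to the reals by \<^const>\<open>of_bool\<close>, so the variable equals 1 with probability p
  and 0 with probability 1 - p (almost surely no other value).\<close>

definition bernoulli_rv :: "'a measure \<Rightarrow> real \<Rightarrow> ('a \<Rightarrow> real) \<Rightarrow> bool" where
  "bernoulli_rv M p X \<longleftrightarrow>
     X \<in> borel_measurable M \<and>
     distr M borel X = distr (measure_pmf (bernoulli_pmf p)) borel of_bool"

definition eta :: "'a measure \<Rightarrow> (nat \<Rightarrow> real) \<Rightarrow> (nat \<Rightarrow> 'a \<Rightarrow> real) \<Rightarrow> nat \<Rightarrow> nat \<Rightarrow> real" where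
  "eta M p X i j =
     (if i = j then 0 else max (integral\<^sup>L M (\<lambda>\<omega>. X i \<omega> * X j \<omega>) - p i * p j) 0)"

text \<open>In the degenerate case B + H = 0, the fraction H / (B + H) formed from the quantities below
  is taken to be 0; this is the value that HOL's division by zero gives.\<close>

definition H_sum :: "'a measure \<Rightarrow> nat \<Rightarrow> (nat \<Rightarrow> real) \<Rightarrow> (nat \<Rightarrow> 'a \<Rightarrow> real) \<Rightarrow> real" where
  "H_sum M n p X = (\<Sum>i=1..n. \<Sum>j=1..n. eta M p X i j)"

definition S_sum :: "nat \<Rightarrow> (nat \<Rightarrow> real) \<Rightarrow> real" where
  "S_sum n p = (\<Sum>i=1..n. p i)"

definition B_sum :: "nat \<Rightarrow> (nat \<Rightarrow> real) \<Rightarrow> real" where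
  "B_sum n p = S_sum n p + (S_sum n p)\<^sup>2"

end

theory Submission
  imports Defs
begin

text \<open>The second-moment method, \<open>P(Z > 0) \<ge> (E Z)\<^sup>2 / E Z\<^sup>2\<close>, together with
  \<open>E Z\<^sup>2 \<le> B + H\<close> gives the lower bound \<open>S\<^sup>2 / (B + H)\<close>. The union bound gives
  \<open>P(Z' > 0) \<le> min 1 S\<close>, and \<open>B * min 1 S \<le> 2 S\<^sup>2\<close>.\<close>

context prob_space
begin

text \<open>An expectation of \<open>f (X \<omega>)\<close> depends on \<open>X\<close> only through
  its law, so it can be computed under \<open>bernoulli_pmf\<close>. The function \<open>f\<close>
  is kept general to cover both the first moment and, with \<open>f x = x * x\<close>, the
  second.\<close>

lemma bernoulli_rv_expectation:
  assumes "bernoulli_rv M p X" and "0 \<le> p" "p \<le> 1" and f: "f \<in> borel_measurable borel"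
  shows "expectation (\<lambda>\<omega>. f (X \<omega>)) = p * f 1 + (1 - p) * f (0::real)"
proof -
  have X: "X \<in> borel_measurable M"
    and d: "distr M borel X = distr (measure_pmf (bernoulli_pmf p)) borel of_bool"
    using assms(1) by (auto simp: bernoulli_rv_def)
  have "expectation (\<lambda>\<omega>. f (X \<omega>)) = integral\<^sup>L (distr M borel X) f"
    by (rule integral_distr[symmetric, OF X f])
  also have "\<dots> = measure_pmf.expectation (bernoulli_pmf p) (\<lambda>b. f (of_bool b))"
    unfolding d by (rule integral_distr[OF _ f]) simp
  also have "\<dots> = p * f 1 + (1 - p) * f 0"
    using assms by (simp add: algebra_simps)
  finally show ?thesis .
qed

text \<open>\<open>bernoulli_rv\<close> fixes only the law of \<open>X\<close>, so the values 0 and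
  1 are guaranteed only almost surely; the pointwise arguments below are therefore carried out under
  \<open>AE\<close>. The claim holds for the law and is pulled back along \<open>X\<close>.\<close>

lemma bernoulli_rv_AE:
  assumes "bernoulli_rv M p X"
  shows "AE \<omega> in M. X \<omega> = 0 \<or> X \<omega> = (1::real)"
proof -
  have X: "X \<in> borel_measurable M"
    and d: "distr M borel X = distr (measure_pmf (bernoulli_pmf p)) borel of_bool"
    using assms by (auto simp: bernoulli_rv_def)
  have s: "{x \<in> space borel. x = 0 \<or> x = (1::real)} \<in> sets borel"
    by measurable
  have "AE x in distr (measure_pmf (bernoulli_pmf p)) borel of_bool. x = 0 \<or> x = (1::real)"
    by (subst AE_distr_iff[OF _ s]) auto
  then show ?thesis
    unfolding d[symmetric] by (subst (asm) AE_distr_iff[OF X s])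
qed

lemma bernoulli_rv_mult_integrable:
  assumes "bernoulli_rv M p X" "bernoulli_rv M q Y"
  shows "integrable M (\<lambda>\<omega>. X \<omega> * Y \<omega>)"
proof (rule integrable_const_bound[where B = 1])
  show "AE \<omega> in M. norm (X \<omega> * Y \<omega>) \<le> 1"
    using bernoulli_rv_AE[OF assms(1)] bernoulli_rv_AE[OF assms(2)] by eventually_elim auto
qed (use assms in \<open>auto simp: bernoulli_rv_def\<close>)

lemma bernoulli_rv_integrable:
  assumes "bernoulli_rv M p X"
  shows "integrable M X"
proof (rule integrable_const_bound[where B = 1])
  show "AE \<omega> in M. norm (X \<omega>) \<le> 1"
    using bernoulli_rv_AE[OF assms] by eventually_elim auto
qed (use assms in \<open>auto simp: bernoulli_rv_def\<close>)

text \<open>Rather than by Cauchy-Schwarz, the bound comes from integrating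
  \<open>2 * t * Z - t\<^sup>2 * Z\<^sup>2 \<le> indicator {Z > 0}\<close> and then choosing
  \<open>t\<close>. Any upper bound \<open>c\<close> of the second moment may serve as the
  denominator.\<close>

lemma second_moment_method:
  fixes Z :: "'a \<Rightarrow> real"
  assumes [measurable]: "random_variable borel Z"
    and pos: "AE \<omega> in M. 0 \<le> Z \<omega>"
    and Z: "integrable M Z" and Z2: "integrable M (\<lambda>\<omega>. (Z \<omega>)\<^sup>2)"
    and le: "expectation (\<lambda>\<omega>. (Z \<omega>)\<^sup>2) \<le> c"
  shows "(expectation Z)\<^sup>2 / c \<le> \<P>(\<omega> in M. Z \<omega> > 0)"
proof (cases "c > 0")
  \<comment> \<open>For \<open>c \<le> 0\<close> the quotient is at most 0 (exactly 0 if
    \<open>c = 0\<close>, by HOL's division), so the bound is trivial.\<close>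
  case False
  then have "(expectation Z)\<^sup>2 / c \<le> 0"
    by (simp add: divide_le_0_iff)
  then show ?thesis
    by (rule order_trans) simp
next
  case True
  define A where "A = {\<omega> \<in> space M. Z \<omega> > 0}"
  have A[measurable]: "A \<in> sets M"
    unfolding A_def by measurable
  \<comment> \<open>This \<open>t\<close> maximises the quadratic
    \<open>2 * t * expectation Z - t\<^sup>2 * c\<close>; the maximum is the desired
    quotient.\<close>
  define t where "t = expectation Z / c"
  have intA: "integrable M (indicator A :: 'a \<Rightarrow> real)"
    using A by (simp add: emeasure_eq_measure)
  have "AE \<omega> in M. 2 * t * Z \<omega> - t\<^sup>2 * (Z \<omega>)\<^sup>2 \<le> indicator A \<omega>"
    using pos AE_space
  proof eventually_elim
    case (elim \<omega>)
    \<comment> \<open>Expanding the square bounds the left-hand side by 1, which suffices where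
      \<open>Z\<close> is positive; where \<open>Z\<close> vanishes, both sides are 0.\<close>
    have "0 \<le> (t * Z \<omega> - 1)\<^sup>2" by simp
    then have "2 * t * Z \<omega> - t\<^sup>2 * (Z \<omega>)\<^sup>2 \<le> 1"
      by (simp add: power2_eq_square algebra_simps)
    then show ?case
      using elim by (cases "Z \<omega> = 0") (auto simp: A_def indicator_def)
  qed
  then have "expectation (\<lambda>\<omega>. 2 * t * Z \<omega> - t\<^sup>2 * (Z \<omega>)\<^sup>2) \<le> expectation (indicator A)"
    using Z Z2 intA by (intro integral_mono_AE) auto
  also have "\<dots> = prob A"
    using A by simp
  also have "expectation (\<lambda>\<omega>. 2 * t * Z \<omega> - t\<^sup>2 * (Z \<omega>)\<^sup>2)
      = 2 * t * expectation Z - t\<^sup>2 * expectation (\<lambda>\<omega>. (Z \<omega>)\<^sup>2)"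
    using Z Z2 by simp
  finally have "2 * t * expectation Z - t\<^sup>2 * expectation (\<lambda>\<omega>. (Z \<omega>)\<^sup>2) \<le> prob A" .
  moreover have "t\<^sup>2 * expectation (\<lambda>\<omega>. (Z \<omega>)\<^sup>2) \<le> t\<^sup>2 * c"
    using le by (intro mult_left_mono) auto
  moreover have "2 * t * expectation Z - t\<^sup>2 * c = (expectation Z)\<^sup>2 / c"
    using True by (simp add: t_def power2_eq_square field_simps)
  ultimately show ?thesis
    by (simp add: A_def)
qed

lemma bernoulli_rv_expectation_eq:
  assumes "bernoulli_rv M p X" and "p \<in> {0..1}"
  shows "expectation X = p"
  using bernoulli_rv_expectation[of p X "\<lambda>x. x"] assms by simp

lemma bernoulli_sum_expectation:
  assumes p: "\<And>i. i \<in> I \<Longrightarrow> p i \<in> {0..1}"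
    and X: "\<And>i. i \<in> I \<Longrightarrow> bernoulli_rv M (p i) (X i)"
  shows "expectation (\<lambda>\<omega>. \<Sum>i\<in>I. X i \<omega>) = (\<Sum>i\<in>I. p i)"
proof -
  have "expectation (\<lambda>\<omega>. \<Sum>i\<in>I. X i \<omega>) = (\<Sum>i\<in>I. expectation (X i))"
    using X by (intro Bochner_Integration.integral_sum bernoulli_rv_integrable)
  also have "\<dots> = (\<Sum>i\<in>I. p i)"
    using p X by (intro sum.cong refl bernoulli_rv_expectation_eq)
  finally show ?thesis .
qed

text \<open>The union bound in integrated form: almost surely the sum dominates the indicator of its
  own positivity, being at least 1 if some \<open>X i\<close> equals 1 and 0 otherwise.\<close>

lemma prob_bernoulli_sum_pos_le:
  assumes "finite I"
    and p: "\<And>i. i \<in> I \<Longrightarrow> p i \<in> {0..1}"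
    and X: "\<And>i. i \<in> I \<Longrightarrow> bernoulli_rv M (p i) (X i)"
  shows "\<P>(\<omega> in M. (\<Sum>i\<in>I. X i \<omega>) > 0) \<le> (\<Sum>i\<in>I. p i)"
proof -
  have [measurable]: "X i \<in> borel_measurable M" if "i \<in> I" for i
    using X[OF that] by (simp add: bernoulli_rv_def)
  define A where "A = {\<omega> \<in> space M. (\<Sum>i\<in>I. X i \<omega>) > 0}"
  have A: "A \<in> sets M"
    unfolding A_def by measurable
  have int: "integrable M (\<lambda>\<omega>. \<Sum>i\<in>I. X i \<omega>)"
    using X by (intro Bochner_Integration.integrable_sum bernoulli_rv_integrable)
  have "AE \<omega> in M. \<forall>i\<in>I. X i \<omega> = 0 \<or> X i \<omega> = 1"
    using X by (intro AE_finite_allI[OF \<open>finite I\<close>] bernoulli_rv_AE)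
  then have "AE \<omega> in M. indicator A \<omega> \<le> (\<Sum>i\<in>I. X i \<omega>)"
  proof eventually_elim
    case (elim \<omega>)
    have nonneg: "X i \<omega> \<ge> 0" if "i \<in> I" for i
      using elim that by force
    show ?case
    proof (cases "\<exists>i\<in>I. X i \<omega> = 1")
      case True
      then obtain i where "i \<in> I" "X i \<omega> = 1" by auto
      then have "1 \<le> (\<Sum>i\<in>I. X i \<omega>)"
        using member_le_sum[of i I "\<lambda>i. X i \<omega>"] nonneg \<open>finite I\<close> by auto
      then show ?thesis
        by (simp add: indicator_def)
    next
      case False
      then have "(\<Sum>i\<in>I. X i \<omega>) = 0"
        using elim by (intro sum.neutral) auto
      then show ?thesis
        by (simp add: A_def)
    qed
  qed
  then have "expectation (indicator A) \<le> expectation (\<lambda>\<omega>. \<Sum>i\<in>I. X i \<omega>)"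
    using int A by (intro integral_mono_AE) (auto simp: emeasure_eq_measure)
  also have "\<dots> = (\<Sum>i\<in>I. p i)"
    using p X by (rule bernoulli_sum_expectation)
  finally show ?thesis
    using A by (simp add: A_def)
qed

text \<open>The square expands into a double sum. Off the diagonal, \<open>eta\<close> absorbs any
  excess of \<open>E[X i * X j]\<close> over \<open>p i * p j\<close>; on the diagonal the second
  moment of a Bernoulli variable is \<open>p i\<close>.\<close>

lemma bernoulli_sum_second_moment_le:
  assumes p: "\<And>i. i \<in> {1..n} \<Longrightarrow> p i \<in> {0..1}"
    and X: "\<And>i. i \<in> {1..n} \<Longrightarrow> bernoulli_rv M (p i) (X i)"
  shows "expectation (\<lambda>\<omega>. (\<Sum>i=1..n. X i \<omega>)\<^sup>2) \<le> B_sum n p + H_sum M n p X"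
proof -
  have int: "integrable M (\<lambda>\<omega>. X i \<omega> * X j \<omega>)" if "i \<in> {1..n}" "j \<in> {1..n}" for i j
    using bernoulli_rv_mult_integrable[OF X[OF that(1)] X[OF that(2)]] .
  have "expectation (\<lambda>\<omega>. (\<Sum>i=1..n. X i \<omega>)\<^sup>2)
      = (\<Sum>i=1..n. \<Sum>j=1..n. expectation (\<lambda>\<omega>. X i \<omega> * X j \<omega>))"
    unfolding power2_eq_square sum_product
    using int
    by (subst Bochner_Integration.integral_sum)
      (auto intro!: Bochner_Integration.integrable_sum sum.cong Bochner_Integration.integral_sum)
  \<comment> \<open>The three summands add up to \<open>S\<^sup>2\<close>, \<open>H\<close> and
    \<open>S\<close>. The diagonal products \<open>p i * p i\<close> are pure slack, kept so that
    the first double sum is the full square.\<close>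
  also have "\<dots> \<le> (\<Sum>i=1..n. \<Sum>j=1..n. p i * p j + eta M p X i j + (if i = j then p i else 0))"
  proof (intro sum_mono)
    fix i j assume ij: "i \<in> {1..n}" "j \<in> {1..n}"
    show "expectation (\<lambda>\<omega>. X i \<omega> * X j \<omega>)
        \<le> p i * p j + eta M p X i j + (if i = j then p i else 0)"
    proof (cases "i = j")
      case True
      then show ?thesis
        using bernoulli_rv_expectation[OF X[OF ij(1)], of "\<lambda>x. x * x"] p[OF ij(1)]
        by (simp add: eta_def)
    qed (auto simp: eta_def)
  qed
  also have "\<dots> = B_sum n p + H_sum M n p X"
    by (simp add: sum.distrib B_sum_def S_sum_def H_sum_def power2_eq_square sum_product)
  finally show ?thesis .
qed

end

theorem proposition5:
  fixes M :: "'a measure" and n :: nat and p :: "nat \<Rightarrow> real"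
    and X X' :: "nat \<Rightarrow> 'a \<Rightarrow> real"
  assumes "prob_space M"
    and "n \<ge> 1"
    and "\<And>i. i \<in> {1..n} \<Longrightarrow> p i \<in> {0..1}"
    and "\<And>i. i \<in> {1..n} \<Longrightarrow> bernoulli_rv M (p i) (X i)"
    and "\<And>i. i \<in> {1..n} \<Longrightarrow> bernoulli_rv M (p i) (X' i)"
    and "prob_space.indep_vars M (\<lambda>_. borel) X' {1..n}"
    and "prob_space.indep_var M
           (PiM {1..n} (\<lambda>_. borel)) (\<lambda>\<omega>. \<lambda>i\<in>{1..n}. X i \<omega>)
           (PiM {1..n} (\<lambda>_. borel)) (\<lambda>\<omega>. \<lambda>i\<in>{1..n}. X' i \<omega>)"
  shows "\<P>(\<omega> in M. (\<Sum>i=1..n. X i \<omega>) > 0)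
           \<ge> 1 / 2 * (1 - H_sum M n p X / (B_sum n p + H_sum M n p X))
               * \<P>(\<omega> in M. (\<Sum>i=1..n. X' i \<omega>) > 0)"
proof -
  interpret prob_space M by fact
  note p = assms(3) and X = assms(4) and X' = assms(5)
  have [measurable]: "X i \<in> borel_measurable M" if "i \<in> {1..n}" for i
    using X[OF that] by (simp add: bernoulli_rv_def)
  define S B H where "S = S_sum n p" and "B = B_sum n p" and "H = H_sum M n p X"
  define P' where "P' = \<P>(\<omega> in M. (\<Sum>i=1..n. X' i \<omega>) > 0)"
  have S: "S \<ge> 0"
    using p by (auto simp: S_def S_sum_def intro!: sum_nonneg)
  have B: "B = S + S\<^sup>2"
    by (simp add: B_def B_sum_def S_def)
  have H: "H \<ge> 0"
    by (auto simp: H_def H_sum_def eta_def intro!: sum_nonneg)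
  have P': "P' \<le> S" "P' \<le> 1" "0 \<le> P'"
    using prob_bernoulli_sum_pos_le[of "{1..n}" p X', OF _ p X']
    by (simp_all add: P'_def S_def S_sum_def)
  have E: "expectation (\<lambda>\<omega>. \<Sum>i=1..n. X i \<omega>) = S"
    unfolding S_def S_sum_def using p X by (rule bernoulli_sum_expectation)
  have "AE \<omega> in M. \<forall>i\<in>{1..n}. X i \<omega> = 0 \<or> X i \<omega> = 1"
    using X by (intro AE_finite_allI bernoulli_rv_AE) auto
  then have nonneg: "AE \<omega> in M. 0 \<le> (\<Sum>i=1..n. X i \<omega>)"
    by eventually_elim (force intro: sum_nonneg)
  have "integrable M (\<lambda>\<omega>. \<Sum>i=1..n. X i \<omega>)"
    using X by (intro Bochner_Integration.integrable_sum bernoulli_rv_integrable)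
  moreover have "integrable M (\<lambda>\<omega>. (\<Sum>i=1..n. X i \<omega>)\<^sup>2)"
    unfolding power2_eq_square sum_product
    using X by (intro Bochner_Integration.integrable_sum bernoulli_rv_mult_integrable)
  moreover have "expectation (\<lambda>\<omega>. (\<Sum>i=1..n. X i \<omega>)\<^sup>2) \<le> B + H"
    unfolding B_def H_def using p X by (rule bernoulli_sum_second_moment_le)
  ultimately have lower: "S\<^sup>2 / (B + H) \<le> \<P>(\<omega> in M. (\<Sum>i=1..n. X i \<omega>) > 0)"
    using nonneg by (intro second_moment_method[of "\<lambda>\<omega>. \<Sum>i=1..n. X i \<omega>", unfolded E]) auto
  have "1 / 2 * (1 - H / (B + H)) * P' \<le> S\<^sup>2 / (B + H)"
  \<comment> \<open>If \<open>S = 0\<close>, then \<open>P' \<le> S\<close> forces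
    \<open>P' = 0\<close> and both sides vanish. This covers the degenerate case
    \<open>B + H = 0\<close>, since \<open>B\<close> and \<open>H\<close> are nonnegative.\<close>
  proof (cases "S = 0")
    case True
    then show ?thesis
      using P' by simp
  next
    case False
    then have pos: "B + H > 0"
      using S H by (simp add: B add_pos_nonneg)
    \<comment> \<open>The two parts of \<open>B = S + S\<^sup>2\<close> call for different bounds:
      \<open>P' \<le> 1\<close> for \<open>S\<^sup>2\<close>, and \<open>P' \<le> S\<close> for
      \<open>S\<close>. Each contributes one \<open>S\<^sup>2\<close>, which is where the factor 1/2
      comes from.\<close>
    have "S\<^sup>2 * P' \<le> S\<^sup>2 * 1" "S * P' \<le> S * S"
      using P' S by (auto simp: mult_left_le intro!: mult_left_mono)
    have "B * P' / 2 \<le> S\<^sup>2"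
      using \<open>S\<^sup>2 * P' \<le> S\<^sup>2 * 1\<close> \<open>S * P' \<le> S * S\<close>
      by (simp add: B power2_eq_square algebra_simps)
    then have "(B * P' / 2) / (B + H) \<le> S\<^sup>2 / (B + H)"
      using pos by (intro divide_right_mono) auto
    \<comment> \<open>Here \<open>1 - H / (B + H)\<close> is \<open>B / (B + H)\<close>, valid since
      the denominator is positive.\<close>
    moreover have "1 / 2 * (1 - H / (B + H)) * P' = (B * P' / 2) / (B + H)"
      using pos by (simp add: field_simps)
    ultimately show ?thesis
      by (simp only:)
  qed
  then show ?thesis
    using lower unfolding B_def H_def P'_def by (rule order_trans)
qed

end
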